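(* Let $(\mathbf{x},\mathbf{y},B,\mathbf{Z})$ be a generalized seed over a semifield $\mathbb{P}$, with $d_i=\deg Z_i$ and $D=(d_i\delta_{ij})$, placed at the initial vertex $t_0$ of $\mathbb{T}_n$. Let $F^t_j(\mathbf{y},\mathbf{z})$ be its $F$-polynomials, and let ${}^LF^t_j$ be the $F$-polynomials of its left-companion cluster algebra, i.e. of the ordinary cluster pattern with initial exchange matrix $DB$ (initial seed $(\mathbf{x}^{1/\mathbf{d}},\mathbf{y},DB)$, $\mathbf{x}^{1/\mathbf{d}}=(x_1^{1/d_1},\dots,x_n^{1/d_n})$). Let $\mathbf{z}^{\mathrm{bin}}=(z^{\mathrm{bin}}_{i,s})$ with $z^{\mathrm{bin}}_{i,s}=\binom{d_i}{s}\in\mathbb{Z}$. Then for any $t\in\mathbb{T}_n$ and any $1\le j\le n$ the following equalities hold in $\mathbb{Q}_{\mathrm{sf}}(\mathbf{y})$ and $\mathbb{Q}_{\mathrm{sf}}(\mathbf{x},\mathbf{y})$ respectively (with $\mathbf{x},\mathbf{y}$ regarded as indeterminates): $$F^t_j(\mathbf{y},\mathbf{z}^{\mathrm{bin}})={}^LF^t_j\big({}^L\mathbf{y}\big)^{d_j}\qquad\text{and}\qquad F^t_j(\hat{\mathbf{y}},\mathbf{z}^{\mathrm{bin}})={}^LF^t_j\big({}^L\hat{\mathbf{y}}\big)^{d_j},$$ where ${}^Ly_i=y_i$, $\hat y_i=y_i\prod_{\ell=1}^n x_\ell^{b_{\ell i}}$ and ${}^L\hat y_i=\hat y_i$.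
   Context: Semifields. A semifield is a multiplicative abelian group $\mathbb{P}$ with an associative, commutative operation $\oplus$ over which multiplication distributes. $\mathbb{P}$ is torsion-free, $\mathbb{ZP}$ is its group ring (a domain), $\mathbb{QP}$ its field of fractions. $\mathbb{Q}_{\mathrm{sf}}(u_1,\dots,u_m)$ is the universal semifield of rational functions in $u_1,\dots,u_m$ that can be written in subtraction-free form (usual operations). $\mathrm{Trop}(u_1,\dots,u_m)$ is the free abelian multiplicative group on the $u_j$ with $\prod u_j^{a_j}\oplus\prod u_j^{b_j}=\prod u_j^{\min(a_j,b_j)}$. Write $[b]_+=\max(b,0)$. Generalized seeds. A generalized seed $(\mathbf{x},\mathbf{y},B,\mathbf{Z})$ over $\mathbb{P}$ consists of: algebraically independent elements $\mathbf{x}=(x_1,\dots,x_n)$ (cluster variables) of a degree-$n$ purely transcendental extension $\mathcal{F}$ of $\mathbb{QP}$ (identified with $\mathbb{QP}(\mathbf{x})$); $\mathbf{y}=(y_1,\dots,y_n)\in\mathbb{P}^n$ (coefficients); a skew-symmetrizable integer $n\times n$ matrix $B=(b_{ij})$; and polynomials $\mathbf{Z}=(Z_1,\dots,Z_n)$, $Z_i(u)=\sum_{s=0}^{d_i}z_{i,s}u^s$ with $d_i\ge1$, $z_{i,s}\in\mathbb{P}$, $z_{i,0}=z_{i,d_i}=1$. Put $\mathbf{z}=(z_{i,s})$ and $Z_i|_{\mathbb{P}}(y)=\bigoplus_{s=0}^{d_i}z_{i,s}y^s$ for $y\in\mathbb{P}$. Mutation. $\mu_k(\mathbf{x},\mathbf{y},B,\mathbf{Z})=(\mathbf{x}',\mathbf{y}',B',\mathbf{Z}')$,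 where $x_i'=x_i$ for $i\ne k$ and $x_k'x_k=\big(\prod_i x_i^{[-b_{ik}]_+}\big)^{d_k}\frac{Z_k(\hat y_k)}{Z_k|_{\mathbb{P}}(y_k)}$ with $\hat y_k=y_k\prod_i x_i^{b_{ik}}$; $y_k'=y_k^{-1}$ and $y_j'=y_j(y_k^{d_k})^{[b_{kj}]_+}Z_k|_{\mathbb{P}}(y_k)^{-b_{kj}}$ for $j\ne k$; $b'_{ij}=-b_{ij}$ if $i=k$ or $j=k$, and $b'_{ij}=b_{ij}+[b_{ik}]_+d_kb_{kj}+b_{ik}d_k[-b_{kj}]_+$ otherwise; $Z_i'=Z_i$ for $i\neq k$ and $Z_k'(u)=u^{d_k}Z_k(u^{-1})$. Patterns. $\mathbb{T}_n$ is the $n$-regular tree with edges labeled by $1,\dots,n$ so that the edges at each vertex have distinct labels. A generalized cluster pattern assigns to each $t\in\mathbb{T}_n$ a generalized seed $(\mathbf{x}^t,\mathbf{y}^t,B^t,\mathbf{Z}^t)$ so that seeds at the ends of an edge labeled $k$ are related by $\mu_k$; it is determined by the seed at the initial vertex $t_0$ (for which the superscript is dropped). An ordinary seed $(\mathbf{x},\mathbf{y},B)$ and its ordinary cluster pattern are the special case $Z_i(u)=1+u$ for all $i$ (so all $d_i=1$, and there are no variables $z_{i,s}$ with $0<s<d_i$). $F$-polynomials. Regard $x_i$, $y_i$ and $z_{i,s}$ ($0<s<d_i$) as independent indeterminates. $X$-functions $X^t_i\in\mathbb{Q}(\mathbf{x},\mathbf{y},\mathbf{z})$ are the cluster variables obtained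 by taking $\mathbb{P}=\mathrm{Trop}(\mathbf{y},\mathbf{z})$; one has $X_i^t\in\mathbb{Z}[\mathbf{x}^{\pm1},\mathbf{y},\mathbf{z}]$. The $F$-polynomials are $F^t_j(\mathbf{y},\mathbf{z})=X^t_j|_{x_1=\cdots=x_n=1}\in\mathbb{Z}[\mathbf{y},\mathbf{z}]$ (in the ordinary case, polynomials in $\mathbf{y}$ only); they admit subtraction-free expressions and depend, as polynomials, only on the initial matrix $B$ and the degrees $d_i$. *)

theory Defs
  imports
    "HOL-Analysis.Analysis"
    "HOL-Library.Poly_Mapping"
    "HOL-Computational_Algebra.Fraction_Field"
begin

section \<open>Semifields\<close>

class semifield = comm_monoid_mult + inverse +
  fixes splus :: "'a \<Rightarrow> 'a \<Rightarrow> 'a"  (infixl "\<oplus>" 65)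
  assumes semifield_left_inverse: "inverse a * a = 1"
    and semifield_divide: "a / b = a * inverse b"
    and splus_assoc: "(a \<oplus> b) \<oplus> c = a \<oplus> (b \<oplus> c)"
    and splus_commute: "a \<oplus> b = b \<oplus> a"
    and splus_distrib: "a * (b \<oplus> c) = a * b \<oplus> a * c"

text \<open>There is no neutral element for \<open>\<oplus>\<close>, so only sums of nonempty lists are meaningful.\<close>

fun splus_list :: "'p::semifield list \<Rightarrow> 'p" where
  "splus_list [] = 1"
| "splus_list [a] = a"
| "splus_list (a # b # as) = a \<oplus> splus_list (b # as)"

text \<open>The tropical semifield: \<open>Trop e\<close> is the Laurent monomial with exponent vector \<open>e\<close>.\<close>

datatype 'v trop = Trop (expo: "'v \<Rightarrow>\<^sub>0 int")

lift_definition min_expo :: "('v \<Rightarrow>\<^sub>0 int) \<Rightarrow> ('v \<Rightarrow>\<^sub>0 int) \<Rightarrow> ('v \<Rightarrow>\<^sub>0 int)"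
  is "\<lambda>f g v. min (f v) (g v)"
proof -
  fix f g :: "'v \<Rightarrow> int"
  assume "finite {v. f v \<noteq> 0}" "finite {v. g v \<noteq> 0}"
  then show "finite {v. min (f v) (g v) \<noteq> 0}"
    by (rule_tac finite_subset[of _ "{v. f v \<noteq> 0} \<union> {v. g v \<noteq> 0}"]) (auto simp: min_def)
qed

lemma min_expo_assoc: "min_expo (min_expo e f) g = min_expo e (min_expo f g)"
  by transfer (simp add: fun_eq_iff min.assoc)

lemma min_expo_commute: "min_expo e f = min_expo f e"
  by transfer (simp add: fun_eq_iff min.commute)

lemma add_min_expo: "e + min_expo f g = min_expo (e + f) (e + g)"
  by transfer (auto simp: fun_eq_iff min_def)

instantiation trop :: (type) inverse
begin

definition "inverse (a :: 'a trop) = Trop (- expo a)"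
definition "(a :: 'a trop) div b = Trop (expo a - expo b)"

instance ..

end

instantiation trop :: (type) semifield
begin

definition "(1 :: 'a trop) = Trop 0"
definition "(a :: 'a trop) * b = Trop (expo a + expo b)"
definition "(a :: 'a trop) \<oplus> b = Trop (min_expo (expo a) (expo b))"

instance
proof
  fix a b c :: "'a trop"
  show "a * b * c = a * (b * c)" "a * b = b * a" "1 * a = a" "inverse a * a = 1"
    "a / b = a * inverse b"
    by (simp_all add: times_trop_def one_trop_def inverse_trop_def divide_trop_def ac_simps)
  show "(a \<oplus> b) \<oplus> c = a \<oplus> (b \<oplus> c)" "a \<oplus> b = b \<oplus> a"
    by (simp_all add: splus_trop_def min_expo_assoc, simp add: min_expo_commute)
  show "a * (b \<oplus> c) = a * b \<oplus> a * c"
    by (simp add: splus_trop_def times_trop_def add_min_expo)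
qed

end

definition trop_gen :: "'v \<Rightarrow> 'v trop" where
  "trop_gen v = Trop (Poly_Mapping.single v 1)"


section \<open>Polynomials, algebraic independence, rational functions\<close>

type_synonym ('v, 'a) mpoly = "('v \<Rightarrow>\<^sub>0 nat) \<Rightarrow>\<^sub>0 'a"

definition mpoly_eval :: "('a::zero \<Rightarrow> 'k::comm_ring_1) \<Rightarrow> ('v \<Rightarrow> 'k) \<Rightarrow> ('v, 'a) mpoly \<Rightarrow> 'k" where
  "mpoly_eval \<phi> x p =
     (\<Sum>m\<in>Poly_Mapping.keys p. \<phi> (Poly_Mapping.lookup p m) *
        (\<Prod>v\<in>Poly_Mapping.keys m. x v ^ Poly_Mapping.lookup m v))"

text \<open>
  The group ring \<open>ZP\<close> consists of the finitely supported maps from \<open>'p\<close> to \<open>int\<close>.  Rather than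
  constructing \<open>QP\<close>, we work in a field \<open>'f\<close> with a map \<open>\<iota>\<close> that induces an injective ring
  homomorphism from \<open>ZP\<close> to \<open>'f\<close>; then \<open>QP\<close> is the subfield of all quotients.
\<close>

definition group_ring_eval :: "('p \<Rightarrow> 'f::field) \<Rightarrow> ('p \<Rightarrow>\<^sub>0 int) \<Rightarrow> 'f" where
  "group_ring_eval \<iota> c = (\<Sum>p\<in>Poly_Mapping.keys c. of_int (Poly_Mapping.lookup c p) * \<iota> p)"

definition coeff_embedding :: "('p::semifield \<Rightarrow> 'f::field) \<Rightarrow> bool" where
  "coeff_embedding \<iota> \<longleftrightarrow>
     \<iota> 1 = 1 \<and> (\<forall>a b. \<iota> (a * b) = \<iota> a * \<iota> b) \<and> (\<forall>c. group_ring_eval \<iota> c = 0 \<longrightarrow> c = 0)"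

definition QP :: "('p::semifield \<Rightarrow> 'f::field) \<Rightarrow> 'f set" where
  "QP \<iota> = {group_ring_eval \<iota> a / group_ring_eval \<iota> b | a b. b \<noteq> 0}"

definition mpolys_over :: "'f::field set \<Rightarrow> ('v, 'f) mpoly set" where
  "mpolys_over K = {p. \<forall>m. Poly_Mapping.lookup p m \<in> K}"

definition alg_independent :: "'f::field set \<Rightarrow> ('v \<Rightarrow> 'f) \<Rightarrow> bool" where
  "alg_independent K x \<longleftrightarrow> (\<forall>p\<in>mpolys_over K. mpoly_eval (\<lambda>c. c) x p = 0 \<longrightarrow> p = 0)"

definition generates_field :: "'f::field set \<Rightarrow> ('v \<Rightarrow> 'f) \<Rightarrow> bool" where
  "generates_field K x \<longleftrightarrow>
     (\<forall>f. \<exists>p\<in>mpolys_over K. \<exists>q\<in>mpolys_over K.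
        mpoly_eval (\<lambda>c. c) x q \<noteq> 0 \<and> f = mpoly_eval (\<lambda>c. c) x p / mpoly_eval (\<lambda>c. c) x q)"

text \<open>
  The indeterminates.  \<open>Zv i s\<close> is used only for \<open>0 < s < d\<^sub>i\<close>; the remaining ones never occur.
\<close>

datatype 'n coefvar = Yv 'n | Zv 'n nat
datatype 'n var = Xv 'n | Cv "'n coefvar"

text \<open>
  The orders on indeterminates carry no meaning: the library needs them to see that polynomials
  over \<open>int\<close> form an integral domain.
\<close>

instantiation coefvar :: (linorder) linorder
begin

definition "a \<le> (b :: 'a coefvar) \<longleftrightarrow>
  (case a of
     Yv i \<Rightarrow> (case b of Yv j \<Rightarrow> i \<le> j | Zv j r \<Rightarrow> True)
   | Zv i s \<Rightarrow> (case b of Yv j \<Rightarrow> False | Zv j r \<Rightarrow> i < j \<or> (i = j \<and> s \<le> r)))"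
definition "a < (b :: 'a coefvar) \<longleftrightarrow> a \<le> b \<and> \<not> b \<le> a"

instance
  by standard (auto simp: less_eq_coefvar_def less_coefvar_def split: coefvar.splits)

end

instantiation var :: (linorder) linorder
begin

definition "a \<le> (b :: 'a var) \<longleftrightarrow>
  (case a of
     Xv i \<Rightarrow> (case b of Xv j \<Rightarrow> i \<le> j | Cv w \<Rightarrow> True)
   | Cv u \<Rightarrow> (case b of Xv j \<Rightarrow> False | Cv w \<Rightarrow> u \<le> w))"
definition "a < (b :: 'a var) \<longleftrightarrow> a \<le> b \<and> \<not> b \<le> a"

instance
  by standard (auto simp: less_eq_var_def less_var_def split: var.splits)

end

type_synonym 'n ratfun = "('n var, int) mpoly fract"

definition rvar :: "'n::linorder var \<Rightarrow> 'n ratfun" where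
  "rvar v = Fract (Poly_Mapping.single (Poly_Mapping.single v 1) 1) 1"

abbreviation "xvar i \<equiv> rvar (Xv i)"
abbreviation "yvar i \<equiv> rvar (Cv (Yv i))"
abbreviation "zvar i s \<equiv> rvar (Cv (Zv i s))"

text \<open>
  Substitution into a rational function, defined when some representing fraction has a denominator
  that does not vanish; the value does not depend on the fraction.
\<close>

definition rat_subst :: "('n::linorder var \<Rightarrow> 'k::field) \<Rightarrow> 'n ratfun \<Rightarrow> 'k" where
  "rat_subst \<sigma> f = (THE r. \<exists>p q. mpoly_eval of_int \<sigma> q \<noteq> 0 \<and> f = Fract p q \<and>
     r = mpoly_eval of_int \<sigma> p / mpoly_eval of_int \<sigma> q)"

inductive_set Qsf :: "'n::linorder var set \<Rightarrow> 'n ratfun set" for U where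
  var: "v \<in> U \<Longrightarrow> rvar v \<in> Qsf U"
| one: "1 \<in> Qsf U"
| add: "f \<in> Qsf U \<Longrightarrow> g \<in> Qsf U \<Longrightarrow> f + g \<in> Qsf U"
| mult: "f \<in> Qsf U \<Longrightarrow> g \<in> Qsf U \<Longrightarrow> f * g \<in> Qsf U"
| divide: "f \<in> Qsf U \<Longrightarrow> g \<in> Qsf U \<Longrightarrow> f / g \<in> Qsf U"

abbreviation y_vars :: "'n var set" where "y_vars \<equiv> range (\<lambda>i. Cv (Yv i))"
abbreviation x_vars :: "'n var set" where "x_vars \<equiv> range Xv"


section \<open>Generalized seeds and mutation\<close>

text \<open>
  The polynomial \<open>Z\<^sub>i\<close> is given by its coefficient list \<open>[z\<^sub>i\<^sub>,\<^sub>0, \<dots>]\<close> of length \<open>d\<^sub>i + 1\<close>.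
\<close>

record ('p, 'f, 'n) seed =
  cluster :: "'n \<Rightarrow> 'f"
  coeffs_y :: "'n \<Rightarrow> 'p"
  exch :: "int ^ 'n ^ 'n"
  polys :: "'n \<Rightarrow> 'p list"

definition deg :: "('p, 'f, 'n::finite) seed \<Rightarrow> 'n \<Rightarrow> nat" where
  "deg S i = length (polys S i) - 1"

definition diag_mat :: "('n::finite \<Rightarrow> nat) \<Rightarrow> int ^ 'n ^ 'n" where
  "diag_mat d = (\<chi> i j. if i = j then int (d i) else 0)"

definition skew_symmetrizable :: "int ^ 'n ^ 'n::finite \<Rightarrow> bool" where
  "skew_symmetrizable B \<longleftrightarrow>
     (\<exists>s. (\<forall>i. s i > 0) \<and> transpose (diag_mat s ** B) = - (diag_mat s ** B))"

definition gen_seed :: "('p::semifield \<Rightarrow> 'f::field) \<Rightarrow> ('p, 'f, 'n::finite) seed \<Rightarrow> bool" where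
  "gen_seed \<iota> S \<longleftrightarrow>
     coeff_embedding \<iota> \<and>
     alg_independent (QP \<iota>) (cluster S) \<and> generates_field (QP \<iota>) (cluster S) \<and>
     skew_symmetrizable (exch S) \<and>
     (\<forall>i. deg S i \<ge> 1 \<and> hd (polys S i) = 1 \<and> last (polys S i) = 1)"

definition pos_part :: "int \<Rightarrow> int" where
  "pos_part b = max b 0"

definition poly_eval_P :: "'p::semifield list \<Rightarrow> 'p \<Rightarrow> 'p" where
  "poly_eval_P zs y = splus_list (map (\<lambda>s. zs ! s * y ^ s) [0..<length zs])"

definition poly_eval_F :: "('p \<Rightarrow> 'f::field) \<Rightarrow> 'p list \<Rightarrow> 'f \<Rightarrow> 'f" where
  "poly_eval_F \<iota> zs u = (\<Sum>s<length zs. \<iota> (zs ! s) * u ^ s)"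

definition y_hat :: "('p \<Rightarrow> 'f::field) \<Rightarrow> ('p, 'f, 'n::finite) seed \<Rightarrow> 'n \<Rightarrow> 'f" where
  "y_hat \<iota> S k = \<iota> (coeffs_y S k) * (\<Prod>i\<in>UNIV. cluster S i powi (exch S $ i $ k))"

definition mutate ::
  "('p::semifield \<Rightarrow> 'f::field) \<Rightarrow> 'n \<Rightarrow> ('p, 'f, 'n::finite) seed \<Rightarrow> ('p, 'f, 'n) seed" where
  "mutate \<iota> k S =
    (let x = cluster S; y = coeffs_y S; b = (\<lambda>i j. exch S $ i $ j); d = deg S;
         ZP = poly_eval_P (polys S k) (y k) in
     \<lparr> cluster = (\<lambda>i. if i = k
          then (\<Prod>l\<in>UNIV. x l powi pos_part (- b l k)) ^ d k
                 * (poly_eval_F \<iota> (polys S k) (y_hat \<iota> S k) / \<iota> ZP) / x k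
          else x i),
       coeffs_y = (\<lambda>j. if j = k then inverse (y k)
          else y j * (y k ^ d k) powi pos_part (b k j) * ZP powi (- b k j)),
       exch = (\<chi> i j. if i = k \<or> j = k then - b i j
          else b i j + pos_part (b i k) * int (d k) * b k j
                 + b i k * int (d k) * pos_part (- b k j)),
       polys = (\<lambda>i. if i = k then rev (polys S k) else polys S i) \<rparr>)"


section \<open>The regular tree and cluster patterns\<close>

text \<open>
  The vertices of the \<open>n\<close>-regular tree are the words in the edge labels without equal neighbouring
  letters: a word lists the labels along the path from the initial vertex \<open>t\<^sub>0 = []\<close>.
\<close>

definition reg_tree :: "'n list set" where
  "reg_tree = {t. distinct_adj t}"

definition tree_edge :: "'n \<Rightarrow> 'n list \<Rightarrow> 'n list \<Rightarrow> bool" where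
  "tree_edge k t t' \<longleftrightarrow> t \<in> reg_tree \<and> t' \<in> reg_tree \<and> (t' = t @ [k] \<or> t = t' @ [k])"

definition cluster_pattern ::
  "('p::semifield \<Rightarrow> 'f::field) \<Rightarrow> ('n list \<Rightarrow> ('p, 'f, 'n::finite) seed) \<Rightarrow> bool" where
  "cluster_pattern \<iota> \<Sigma> \<longleftrightarrow> (\<forall>k t t'. tree_edge k t t' \<longrightarrow> \<Sigma> t' = mutate \<iota> k (\<Sigma> t))"

definition seed_at ::
  "('p::semifield \<Rightarrow> 'f::field) \<Rightarrow> ('p, 'f, 'n::finite) seed \<Rightarrow> 'n list \<Rightarrow> ('p, 'f, 'n) seed" where
  "seed_at \<iota> S t = fold (mutate \<iota>) t S"

text \<open>The seeds of a cluster pattern are determined by the initial seed, namely by \<open>seed_at\<close>.\<close>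

lemma cluster_pattern_seed_at:
  assumes "cluster_pattern \<iota> \<Sigma>" "\<Sigma> [] = S" "t \<in> reg_tree"
  shows "\<Sigma> t = seed_at \<iota> S t"
  using assms(3)
proof (induction t rule: rev_induct)
  case Nil
  then show ?case by (simp add: assms(2) seed_at_def)
next
  case (snoc k t)
  have t: "t \<in> reg_tree"
    using snoc.prems by (auto simp: reg_tree_def distinct_adj_append_iff)
  then have "tree_edge k t (t @ [k])"
    using snoc.prems by (simp add: tree_edge_def)
  then have "\<Sigma> (t @ [k]) = mutate \<iota> k (\<Sigma> t)"
    using assms(1) unfolding cluster_pattern_def by blast
  then show ?case using snoc.IH[OF t] by (simp add: seed_at_def)
qed


section \<open>X-functions and F-polynomials\<close>

definition trop_embed :: "'n::linorder coefvar trop \<Rightarrow> 'n ratfun" where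
  "trop_embed m =
     (\<Prod>v\<in>Poly_Mapping.keys (expo m). rvar (Cv v) powi Poly_Mapping.lookup (expo m) v)"

text \<open>The initial seed with independent indeterminates over the tropical semifield.\<close>

definition indet_seed :: "int ^ ('n::{finite,linorder}) ^ ('n::{finite,linorder}) \<Rightarrow> ('n \<Rightarrow> nat) \<Rightarrow>
    ('n coefvar trop, 'n ratfun, 'n::{finite,linorder}) seed" where
  "indet_seed B d =
     \<lparr> cluster = (\<lambda>i. xvar i),
       coeffs_y = (\<lambda>i. trop_gen (Yv i)),
       exch = B,
       polys = (\<lambda>i. map (\<lambda>s. if s = 0 \<or> s = d i then 1 else trop_gen (Zv i s)) [0..<Suc (d i)]) \<rparr>"

definition X_function ::
  "int ^ ('n::{finite,linorder}) ^ ('n::{finite,linorder}) \<Rightarrow> ('n \<Rightarrow> nat) \<Rightarrow> 'n list \<Rightarrow> 'n \<Rightarrow> 'n::{finite,linorder} ratfun" where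
  "X_function B d t j = cluster (seed_at trop_embed (indet_seed B d) t) j"

definition F_polynomial ::
  "int ^ ('n::{finite,linorder}) ^ ('n::{finite,linorder}) \<Rightarrow> ('n \<Rightarrow> nat) \<Rightarrow> 'n list \<Rightarrow> 'n \<Rightarrow> 'n::{finite,linorder} ratfun" where
  "F_polynomial B d t j =
     rat_subst (case_var (\<lambda>i. 1) (\<lambda>w. rvar (Cv w))) (X_function B d t j)"

definition gen_F ::
  "('p, 'f, 'n) seed \<Rightarrow> 'n list \<Rightarrow> 'n \<Rightarrow> 'n::{finite,linorder} ratfun" where
  "gen_F S t j = F_polynomial (exch S) (deg S) t j"

text \<open>
  The F-polynomials of the left companion: the ordinary case (all degrees 1) with initial exchange
  matrix \<open>DB\<close>.  They do not involve the initial cluster of roots of the \<open>x\<^sub>i\<close>.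
\<close>

definition left_F ::
  "('p, 'f, 'n) seed \<Rightarrow> 'n list \<Rightarrow> 'n \<Rightarrow> 'n::{finite,linorder} ratfun" where
  "left_F S t j = F_polynomial (diag_mat (deg S) ** exch S) (\<lambda>i. 1) t j"

definition subst_yz :: "'n ratfun \<Rightarrow> ('n \<Rightarrow> 'n ratfun) \<Rightarrow> ('n \<Rightarrow> nat \<Rightarrow> 'n ratfun) \<Rightarrow>
    'n::linorder ratfun" where
  "subst_yz F y z = rat_subst (case_var (\<lambda>i. xvar i) (case_coefvar y z)) F"

definition subst_y :: "'n ratfun \<Rightarrow> ('n \<Rightarrow> 'n ratfun) \<Rightarrow> 'n::linorder ratfun" where
  "subst_y F y = subst_yz F y (\<lambda>i s. zvar i s)"

definition z_bin :: "('n \<Rightarrow> nat) \<Rightarrow> 'n \<Rightarrow> nat \<Rightarrow> 'n::linorder ratfun" where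
  "z_bin d i s = of_nat (d i choose s)"

definition y_hat_var :: "int ^ ('n::{finite,linorder}) ^ ('n::{finite,linorder}) \<Rightarrow> 'n \<Rightarrow> 'n::{finite,linorder} ratfun" where
  "y_hat_var B i = yvar i * (\<Prod>l\<in>UNIV. xvar l powi (B $ l $ i))"

end

(*
  Specializing z to binomial coefficients is a homomorphism of semifields on the subtraction-free
  rational functions, so both equalities can be proved along the whole pattern by applying it to
  the X-functions. It turns Z_k(u) into (1 + u)^(d_k). The tropical y-variables of the pattern and
  of its left companion coincide, because tropically Z_k|_P(y_k) = (1 + y_k)^(d_k); in particular
  they do not involve z. Hence each exchange relation of the generalized pattern becomes the
  d_k-th power of the one of the companion pattern, and by induction X_i becomes the d_i-th power
  of its companion.
*)

theory Submission
  imports Defs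
begin

section \<open>Evaluation of polynomials and substitution into rational functions\<close>

lemma mpoly_eval_superset:
  assumes "finite M" "Poly_Mapping.keys p \<subseteq> M" "\<phi> 0 = 0"
  shows "mpoly_eval \<phi> x p = (\<Sum>m\<in>M. \<phi> (Poly_Mapping.lookup p m) *
           (\<Prod>v\<in>Poly_Mapping.keys m. x v ^ Poly_Mapping.lookup m v))"
  unfolding mpoly_eval_def
  by (rule sum.mono_neutral_left) (use assms in \<open>auto simp: in_keys_iff\<close>)

lemma mpoly_eval_add:
  "mpoly_eval of_int x (p + q) = mpoly_eval of_int x p + mpoly_eval of_int x q"
proof -
  let ?M = "Poly_Mapping.keys p \<union> Poly_Mapping.keys q"
  have "Poly_Mapping.keys (p + q) \<subseteq> ?M" by (rule Poly_Mapping.keys_add)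
  then show ?thesis
    by (simp add: mpoly_eval_superset[of ?M] lookup_add distrib_right sum.distrib)
qed

lemma mpoly_eval_single:
  "mpoly_eval of_int x (Poly_Mapping.single m c) =
     of_int c * (\<Prod>v\<in>Poly_Mapping.keys m. x v ^ Poly_Mapping.lookup m v)"
  by (simp add: mpoly_eval_superset[of "{m}"])

lemma mpoly_eval_0 [simp]: "mpoly_eval \<phi> x 0 = 0"
  by (simp add: mpoly_eval_def)

lemma mpoly_eval_1 [simp]: "mpoly_eval of_int x 1 = 1"
  using mpoly_eval_single[of x 0 1] by simp

lemma mpoly_eval_sum:
  "mpoly_eval of_int x (\<Sum>i\<in>I. f i) = (\<Sum>i\<in>I. mpoly_eval of_int x (f i))"
  by (induction I rule: infinite_finite_induct) (simp_all add: mpoly_eval_add)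

lemma prod_power_superset:
  fixes x :: "'v \<Rightarrow> 'k::comm_monoid_mult"
  assumes "finite M" "Poly_Mapping.keys m \<subseteq> M"
  shows "(\<Prod>v\<in>Poly_Mapping.keys m. x v ^ Poly_Mapping.lookup m v) =
         (\<Prod>v\<in>M. x v ^ Poly_Mapping.lookup m v)"
  by (rule prod.mono_neutral_left) (use assms in \<open>auto simp: in_keys_iff\<close>)

lemma prod_power_add:
  fixes x :: "'v \<Rightarrow> 'k::comm_monoid_mult"
  shows "(\<Prod>v\<in>Poly_Mapping.keys (m + n). x v ^ Poly_Mapping.lookup (m + n) v) =
    (\<Prod>v\<in>Poly_Mapping.keys m. x v ^ Poly_Mapping.lookup m v) *
    (\<Prod>v\<in>Poly_Mapping.keys n. x v ^ Poly_Mapping.lookup n v)"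
proof -
  let ?M = "Poly_Mapping.keys m \<union> Poly_Mapping.keys n"
  have "Poly_Mapping.keys (m + n) \<subseteq> ?M" by (rule Poly_Mapping.keys_add)
  then have "(\<Prod>v\<in>Poly_Mapping.keys (m + n). x v ^ Poly_Mapping.lookup (m + n) v) =
      (\<Prod>v\<in>?M. x v ^ Poly_Mapping.lookup m v * x v ^ Poly_Mapping.lookup n v)"
    by (subst prod_power_superset[of ?M]) (simp_all add: lookup_add power_add)
  then show ?thesis
    by (simp add: prod_power_superset[of ?M] prod.distrib)
qed

lemma mpoly_eval_mult:
  fixes p q :: "('v, int) mpoly"
  shows "mpoly_eval of_int x (p * q) = mpoly_eval of_int x p * mpoly_eval of_int x q"
proof -
  \<comment> \<open>A polynomial is the sum of its monomials; on monomials, multiplicativity is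
    \<open>prod_power_add\<close>.\<close>
  have decomp: "r = (\<Sum>m\<in>Poly_Mapping.keys r. Poly_Mapping.single m (Poly_Mapping.lookup r m))"
    for r :: "('v \<Rightarrow>\<^sub>0 nat) \<Rightarrow>\<^sub>0 int"
    by (rule poly_mapping_eqI) (auto simp: lookup_sum lookup_single when_def in_keys_iff sum.delta)
  have "p * q = (\<Sum>m\<in>Poly_Mapping.keys p. \<Sum>n\<in>Poly_Mapping.keys q.
      Poly_Mapping.single (m + n) (Poly_Mapping.lookup p m * Poly_Mapping.lookup q n))"
    by (subst decomp[of p], subst decomp[of q]) (simp add: sum_product mult_single)
  then have "mpoly_eval of_int x (p * q) =
     (\<Sum>m\<in>Poly_Mapping.keys p. \<Sum>n\<in>Poly_Mapping.keys q.
      (of_int (Poly_Mapping.lookup p m) *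
         (\<Prod>v\<in>Poly_Mapping.keys m. x v ^ Poly_Mapping.lookup m v)) *
      (of_int (Poly_Mapping.lookup q n) *
         (\<Prod>v\<in>Poly_Mapping.keys n. x v ^ Poly_Mapping.lookup n v)))"
    by (simp add: mpoly_eval_sum mpoly_eval_single prod_power_add mult_ac)
  then show ?thesis by (simp add: mpoly_eval_def sum_product)
qed

text \<open>Equal fractions satisfy a cross-multiplied identity of polynomials; evaluating it shows
  that their values agree, so the description in \<open>rat_subst\<close> has a unique
  solution.\<close>

lemma rat_subst_Fract:
  assumes q: "mpoly_eval of_int \<sigma> q \<noteq> 0"
  shows "rat_subst \<sigma> (Fract p q) = mpoly_eval of_int \<sigma> p / mpoly_eval of_int \<sigma> q"
  unfolding rat_subst_def
proof (rule the_equality)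
  fix r
  assume "\<exists>p' q'. mpoly_eval of_int \<sigma> q' \<noteq> 0 \<and> Fract p q = Fract p' q' \<and>
            r = mpoly_eval of_int \<sigma> p' / mpoly_eval of_int \<sigma> q'"
  then obtain p' q' where q': "mpoly_eval of_int \<sigma> q' \<noteq> 0" and eq: "Fract p q = Fract p' q'"
    and r: "r = mpoly_eval of_int \<sigma> p' / mpoly_eval of_int \<sigma> q'" by blast
  have "q \<noteq> 0" "q' \<noteq> 0" using q q' by auto
  then have "p * q' = p' * q" using eq by (simp add: eq_fract)
  then have "mpoly_eval of_int \<sigma> p * mpoly_eval of_int \<sigma> q' =
             mpoly_eval of_int \<sigma> p' * mpoly_eval of_int \<sigma> q"
    by (simp flip: mpoly_eval_mult)
  then show "r = mpoly_eval of_int \<sigma> p / mpoly_eval of_int \<sigma> q"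
    using q q' r by (simp add: frac_eq_eq)
qed (use q in blast)


section \<open>Subtraction-free sets and their homomorphisms\<close>

text \<open>A semifield inside a field, with the addition of the field as \<oplus>. Excluding
  \<open>0\<close> makes every quotient genuine.\<close>

definition sf_closed :: "'a::field set \<Rightarrow> bool" where
  "sf_closed A \<longleftrightarrow> 1 \<in> A \<and> 0 \<notin> A \<and>
     (\<forall>a\<in>A. \<forall>b\<in>A. a + b \<in> A \<and> a * b \<in> A \<and> a / b \<in> A)"

definition sf_hom :: "'a::field set \<Rightarrow> 'b::field set \<Rightarrow> ('a \<Rightarrow> 'b) \<Rightarrow> bool" where
  "sf_hom A B \<phi> \<longleftrightarrow> sf_closed A \<and> sf_closed B \<and> \<phi> ` A \<subseteq> B \<and> \<phi> 1 = 1 \<and>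
     (\<forall>a\<in>A. \<forall>b\<in>A. \<phi> (a + b) = \<phi> a + \<phi> b \<and> \<phi> (a * b) = \<phi> a * \<phi> b \<and> \<phi> (a / b) = \<phi> a / \<phi> b)"

lemma sf_closed_power: "sf_closed A \<Longrightarrow> a \<in> A \<Longrightarrow> a ^ n \<in> A"
  by (induction n) (auto simp: sf_closed_def)

lemma sf_closed_powi:
  assumes "sf_closed A" "a \<in> A"
  shows "a powi n \<in> A"
proof (cases "n \<ge> 0")
  case False
  then have "a powi n = 1 / a ^ nat (- n)"
    by (simp add: power_int_def field_simps)
  then show ?thesis using assms sf_closed_power[OF assms] by (auto simp: sf_closed_def)
qed (use sf_closed_power[OF assms] in \<open>simp add: power_int_def\<close>)

lemma sf_closed_prod: "sf_closed A \<Longrightarrow> (\<And>i. i \<in> I \<Longrightarrow> f i \<in> A) \<Longrightarrow> (\<Prod>i\<in>I. f i) \<in> A"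
  by (induction I rule: infinite_finite_induct) (auto simp: sf_closed_def)

lemma sf_closed_sum:
  "finite I \<Longrightarrow> I \<noteq> {} \<Longrightarrow> sf_closed A \<Longrightarrow> (\<And>i. i \<in> I \<Longrightarrow> f i \<in> A) \<Longrightarrow> (\<Sum>i\<in>I. f i) \<in> A"
  by (induction I rule: finite_ne_induct) (auto simp: sf_closed_def)

text \<open>The sum of \<open>n\<close> ones, nonempty for \<open>n > 0\<close>. This places the
  binomial coefficients in the target semifield.\<close>

lemma sf_closed_of_nat: "sf_closed A \<Longrightarrow> n > 0 \<Longrightarrow> of_nat n \<in> A"
  using sf_closed_sum[of "{..<n}" A "\<lambda>_. 1"] by (auto simp: sf_closed_def)

lemma sf_hom_comp: "sf_hom A B \<phi> \<Longrightarrow> sf_hom B C \<psi> \<Longrightarrow> sf_hom A C (\<psi> \<circ> \<phi>)"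
  by (auto simp: sf_hom_def image_subset_iff)

lemma sf_hom_power: "sf_hom A B \<phi> \<Longrightarrow> a \<in> A \<Longrightarrow> \<phi> (a ^ n) = \<phi> a ^ n"
proof (induction n)
  case (Suc n)
  then show ?case using sf_closed_power[of A a n] by (auto simp: sf_hom_def)
qed (simp add: sf_hom_def)

lemma sf_hom_powi:
  assumes "sf_hom A B \<phi>" "a \<in> A"
  shows "\<phi> (a powi n) = \<phi> a powi n"
proof (cases "n \<ge> 0")
  case False
  have A: "a ^ nat (- n) \<in> A" "1 \<in> A"
    using assms sf_closed_power by (auto simp: sf_hom_def sf_closed_def)
  have "a powi n = 1 / a ^ nat (- n)" "\<phi> a powi n = 1 / \<phi> a ^ nat (- n)"
    using False by (simp_all add: power_int_def field_simps)
  then show ?thesis using assms A sf_hom_power[OF assms] by (auto simp: sf_hom_def)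
qed (use sf_hom_power[OF assms] in \<open>simp add: power_int_def\<close>)

lemma sf_hom_prod:
  assumes "sf_hom A B \<phi>" "\<And>i. i \<in> I \<Longrightarrow> f i \<in> A"
  shows "\<phi> (\<Prod>i\<in>I. f i) = (\<Prod>i\<in>I. \<phi> (f i))"
  using assms(2)
proof (induction I rule: infinite_finite_induct)
  case (insert i I)
  then have "(\<Prod>i\<in>I. f i) \<in> A" using assms(1) by (auto simp: sf_hom_def intro: sf_closed_prod)
  then show ?case using assms(1) insert by (auto simp: sf_hom_def)
qed (use assms(1) in \<open>auto simp: sf_hom_def\<close>)

lemma sf_hom_sum:
  assumes "finite I" "I \<noteq> {}" "sf_hom A B \<phi>" "\<And>i. i \<in> I \<Longrightarrow> f i \<in> A"
  shows "\<phi> (\<Sum>i\<in>I. f i) = (\<Sum>i\<in>I. \<phi> (f i))"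
  using assms(1,2,4)
proof (induction I rule: finite_ne_induct)
  case (insert i I)
  then have "(\<Sum>i\<in>I. f i) \<in> A" using assms(3) by (auto simp: sf_hom_def intro: sf_closed_sum)
  then show ?case using assms(3) insert by (auto simp: sf_hom_def)
qed simp

text \<open>The fraction is built along the subtraction-free expression, so that numerator and
  denominator both take values in \<open>B\<close>, hence nonzero ones. The numerator is controlled
  too because division turns it into a denominator.\<close>

lemma Qsf_Fract_eval:
  assumes "f \<in> Qsf V" and B: "sf_closed B" and \<sigma>: "\<And>v. v \<in> V \<Longrightarrow> \<sigma> v \<in> B"
  shows "\<exists>p q. mpoly_eval of_int \<sigma> p \<in> B \<and> mpoly_eval of_int \<sigma> q \<in> B \<and> f = Fract p q"
  using assms(1)
proof (induction rule: Qsf.induct)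
  case (var v)
  have "mpoly_eval of_int \<sigma> (Poly_Mapping.single (Poly_Mapping.single v 1) 1) = \<sigma> v"
    by (simp add: mpoly_eval_single)
  then show ?case using \<sigma>[OF var] B unfolding rvar_def sf_closed_def
    by (metis mpoly_eval_1)
next
  case one
  then show ?case using B unfolding sf_closed_def by (metis mpoly_eval_1 One_fract_def)
next
  case (add f g)
  then obtain p q p' q' where *: "mpoly_eval of_int \<sigma> p \<in> B" "mpoly_eval of_int \<sigma> q \<in> B" "f = Fract p q"
    "mpoly_eval of_int \<sigma> p' \<in> B" "mpoly_eval of_int \<sigma> q' \<in> B" "g = Fract p' q'" by blast
  then have "q \<noteq> 0" "q' \<noteq> 0" using B by (auto simp: sf_closed_def)
  then have "f + g = Fract (p * q' + p' * q) (q * q')" using * by simp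
  moreover have "mpoly_eval of_int \<sigma> (p * q' + p' * q) \<in> B" "mpoly_eval of_int \<sigma> (q * q') \<in> B"
    using * B by (simp_all add: mpoly_eval_add mpoly_eval_mult sf_closed_def)
  ultimately show ?case by blast
next
  case (mult f g)
  then obtain p q p' q' where *: "mpoly_eval of_int \<sigma> p \<in> B" "mpoly_eval of_int \<sigma> q \<in> B" "f = Fract p q"
    "mpoly_eval of_int \<sigma> p' \<in> B" "mpoly_eval of_int \<sigma> q' \<in> B" "g = Fract p' q'" by blast
  then have "f * g = Fract (p * p') (q * q')" by simp
  moreover have "mpoly_eval of_int \<sigma> (p * p') \<in> B" "mpoly_eval of_int \<sigma> (q * q') \<in> B"
    using * B by (simp_all add: mpoly_eval_mult sf_closed_def)
  ultimately show ?case by blast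
next
  case (divide f g)
  then obtain p q p' q' where *: "mpoly_eval of_int \<sigma> p \<in> B" "mpoly_eval of_int \<sigma> q \<in> B" "f = Fract p q"
    "mpoly_eval of_int \<sigma> p' \<in> B" "mpoly_eval of_int \<sigma> q' \<in> B" "g = Fract p' q'" by blast
  then have "f / g = Fract (p * q') (q * p')" by simp
  moreover have "mpoly_eval of_int \<sigma> (p * q') \<in> B" "mpoly_eval of_int \<sigma> (q * p') \<in> B"
    using * B by (simp_all add: mpoly_eval_mult sf_closed_def)
  ultimately show ?case by blast
qed

text \<open>Setting all variables to \<open>1 :: real\<close> shows that \<open>0\<close> is not subtraction-free.\<close>

lemma sf_closed_Qsf:
  fixes U :: "'a::linorder var set"
  shows "sf_closed (Qsf U)"
proof -
  have "0 \<notin> Qsf U"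
  proof
    assume "0 \<in> Qsf U"
    moreover have B: "sf_closed {r::real. r > 0}" by (auto simp: sf_closed_def)
    ultimately have "\<exists>p q. mpoly_eval of_int (\<lambda>_. 1::real) p \<in> {r. r > 0} \<and>
        mpoly_eval of_int (\<lambda>_. 1::real) q \<in> {r. r > 0} \<and> (0 :: 'a ratfun) = Fract p q"
      by (rule Qsf_Fract_eval) simp
    then obtain p q where *: "mpoly_eval of_int (\<lambda>_. 1::real) p > 0"
      "mpoly_eval of_int (\<lambda>_. 1::real) q > 0" "(0 :: 'a ratfun) = Fract p q"
      by blast
    then have "p \<noteq> 0" "q \<noteq> 0" by auto
    with *(3) show False by (simp add: Zero_fract_def eq_fract)
  qed
  then show ?thesis by (auto simp: sf_closed_def intro: Qsf.intros)
qed

lemma rat_subst_rvar: "rat_subst \<sigma> (rvar v) = \<sigma> v"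
  by (simp add: rvar_def rat_subst_Fract mpoly_eval_single)

text \<open>The universal property of \<open>Qsf V\<close>: the fractions from
  \<open>Qsf_Fract_eval\<close> have denominators that do not vanish under \<open>\<sigma>\<close>,
  so substitution is defined everywhere on \<open>Qsf V\<close> and respects the operations.\<close>

lemma sf_hom_rat_subst:
  assumes B: "sf_closed B" and \<sigma>: "\<And>v. v \<in> V \<Longrightarrow> \<sigma> v \<in> B"
  shows "sf_hom (Qsf V) B (rat_subst \<sigma>)"
proof -
  let ?e = "mpoly_eval of_int \<sigma>"
  have ex: "\<exists>p q. ?e p \<noteq> 0 \<and> ?e q \<noteq> 0 \<and> f = Fract p q \<and> ?e p \<in> B \<and> ?e q \<in> B" if "f \<in> Qsf V" for f
  proof -
    have "b \<noteq> 0" if "b \<in> B" for b using B that by (auto simp: sf_closed_def)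
    then show ?thesis using Qsf_Fract_eval[of f V B \<sigma>, OF that assms] by blast
  qed
  have "rat_subst \<sigma> f \<in> B" if "f \<in> Qsf V" for f
    using ex[OF that] B by (auto simp: rat_subst_Fract sf_closed_def)
  moreover have "rat_subst \<sigma> 1 = 1"
    using rat_subst_Fract[of \<sigma> 1 1] by (simp add: One_fract_def)
  moreover have "rat_subst \<sigma> (f + g) = rat_subst \<sigma> f + rat_subst \<sigma> g \<and>
      rat_subst \<sigma> (f * g) = rat_subst \<sigma> f * rat_subst \<sigma> g \<and>
      rat_subst \<sigma> (f / g) = rat_subst \<sigma> f / rat_subst \<sigma> g"
    if fg: "f \<in> Qsf V" "g \<in> Qsf V" for f g
  proof -
    obtain p q where f: "?e p \<noteq> 0" "?e q \<noteq> 0" "f = Fract p q" using ex[OF fg(1)] by blast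
    obtain p' q' where g: "?e p' \<noteq> 0" "?e q' \<noteq> 0" "g = Fract p' q'" using ex[OF fg(2)] by blast
    have "q \<noteq> 0" "q' \<noteq> 0" using f g by auto
    then show ?thesis using f g
      by (simp add: rat_subst_Fract mpoly_eval_add mpoly_eval_mult add_frac_eq)
  qed
  ultimately show ?thesis using B by (auto simp: sf_hom_def sf_closed_Qsf)
qed


section \<open>Tropical coefficients\<close>

abbreviation trop_lookup :: "'v trop \<Rightarrow> 'v \<Rightarrow> int" where
  "trop_lookup a \<equiv> Poly_Mapping.lookup (expo a)"

lemma trop_eqI: "(\<And>v. trop_lookup a v = trop_lookup b v) \<Longrightarrow> a = b"
  by (simp add: trop.expand poly_mapping_eqI)

lemma trop_lookup_simps [simp]:
  "trop_lookup 1 v = 0"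
  "trop_lookup (a * b) v = trop_lookup a v + trop_lookup b v"
  "trop_lookup (inverse a) v = - trop_lookup a v"
  "trop_lookup (a \<oplus> b) v = min (trop_lookup a v) (trop_lookup b v)"
  "trop_lookup (trop_gen w) v = (if v = w then 1 else 0)"
  by (simp_all add: one_trop_def times_trop_def inverse_trop_def splus_trop_def lookup_add
      min_expo.rep_eq trop_gen_def lookup_single when_def)

lemma trop_lookup_power [simp]: "trop_lookup (a ^ n) v = int n * trop_lookup a v"
  by (induction n) (simp_all add: algebra_simps)

lemma trop_lookup_powi [simp]: "trop_lookup (a powi n) v = n * trop_lookup a v"
  by (simp add: power_int_def)

lemma trop_lookup_splus_list:
  "as \<noteq> [] \<Longrightarrow> trop_lookup (splus_list as) v = Min ((\<lambda>a. trop_lookup a v) ` set as)"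
  by (induction as rule: splus_list.induct) simp_all

text \<open>Only the two extreme coefficients of \<open>Z\<^sub>i\<close> contribute to its tropical values.\<close>

lemma trop_lookup_poly_eval_P:
  assumes zs: "length zs = Suc d" "zs ! 0 = 1" "zs ! d = 1"
    and nonneg: "\<And>s. s \<le> d \<Longrightarrow> trop_lookup (zs ! s) v \<ge> 0"
  shows "trop_lookup (poly_eval_P zs y) v = int d * min 0 (trop_lookup y v)"
proof -
  let ?e = "trop_lookup y v"
  have "trop_lookup (poly_eval_P zs y) v =
      Min ((\<lambda>s. trop_lookup (zs ! s) v + int s * ?e) ` {0..<Suc d})"
    by (simp add: poly_eval_P_def trop_lookup_splus_list zs image_image del: upt_Suc)
  also have "\<dots> = int d * min 0 ?e"
  proof (rule Min_eqI)
    fix r assume "r \<in> (\<lambda>s. trop_lookup (zs ! s) v + int s * ?e) ` {0..<Suc d}"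
    then obtain s where "s \<in> {0..<Suc d}" and r: "r = trop_lookup (zs ! s) v + int s * ?e" by blast
    then have s: "s \<le> d" by simp
    have "int d * min 0 ?e \<le> int s * min 0 ?e"
      by (rule mult_right_mono_neg) (use s in auto)
    also have "\<dots> \<le> int s * ?e" by (rule mult_left_mono) auto
    finally show "int d * min 0 ?e \<le> r" using nonneg[OF s] r by simp
  next
    show "int d * min 0 ?e \<in> (\<lambda>s. trop_lookup (zs ! s) v + int s * ?e) ` {0..<Suc d}"
    \<comment> \<open>The minimum is attained at an end of the list, where the coefficient is
      \<open>1\<close>: at \<open>0\<close> for \<open>?e \<ge> 0\<close>, at \<open>d\<close>
      otherwise.\<close>
    proof (cases "?e \<ge> 0")
      case True
      then show ?thesis using zs by (intro image_eqI[of _ _ 0]) auto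
    next
      case False
      then show ?thesis using zs by (intro image_eqI[of _ _ d]) auto
    qed
  qed simp
  finally show ?thesis .
qed

lemma trop_embed_superset:
  assumes "finite M" "Poly_Mapping.keys (expo m) \<subseteq> M"
  shows "trop_embed m = (\<Prod>v\<in>M. rvar (Cv v) powi trop_lookup m v)"
  unfolding trop_embed_def
  by (rule prod.mono_neutral_left) (use assms in \<open>auto simp: in_keys_iff\<close>)

lemma trop_embed_power: "trop_embed (a ^ n) = trop_embed a ^ n"
proof -
  have "Poly_Mapping.keys (expo (a ^ n)) \<subseteq> Poly_Mapping.keys (expo a)"
    by (auto simp: in_keys_iff)
  then have "trop_embed (a ^ n) =
      (\<Prod>v\<in>Poly_Mapping.keys (expo a). rvar (Cv v) powi (trop_lookup a v * int n))"
    by (simp add: trop_embed_superset[of "Poly_Mapping.keys (expo a)"] mult.commute)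
  then show ?thesis
    by (simp add: trop_embed_def prod_power_distrib power_int_mult)
qed

lemma trop_embed_1 [simp]: "trop_embed 1 = 1"
  by (simp add: trop_embed_def one_trop_def)

lemma trop_embed_gen [simp]: "trop_embed (trop_gen v) = rvar (Cv v)"
  by (simp add: trop_embed_def trop_gen_def)


section \<open>Binomial specialization of the companion patterns\<close>

text \<open>\<open>\<Phi>\<close> specializes the generalized pattern and \<open>\<Psi>\<close> its
  left companion. Their domains \<open>A\<close> and \<open>A'\<close> may differ, since only the
  former pattern involves z. The common target \<open>T\<close> stays open so that y and y-hat can
  both be substituted.\<close>

locale binomial_specialization =
  fixes d :: "'n::{finite,linorder} \<Rightarrow> nat"
    and A A' :: "'n ratfun set" and T :: "'k::field set"
    and \<Phi> \<Psi> :: "'n ratfun \<Rightarrow> 'k"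
  assumes hom: "sf_hom A T \<Phi>" and hom': "sf_hom A' T \<Psi>"
    and d_pos: "\<And>i. d i > 0"
    and y_in: "\<And>i. yvar i \<in> A" and y_in': "\<And>i. yvar i \<in> A'"
    and y_eq: "\<And>i. \<Phi> (yvar i) = \<Psi> (yvar i)"
    and z_in: "\<And>i s. 0 < s \<Longrightarrow> s < d i \<Longrightarrow> zvar i s \<in> A"
    and z_eq: "\<And>i s. 0 < s \<Longrightarrow> s < d i \<Longrightarrow> \<Phi> (zvar i s) = of_nat (d i choose s)"
begin

lemma closed: "sf_closed A" and closed': "sf_closed A'"
  using hom hom' by (simp_all add: sf_hom_def)

text \<open>The invariant carried along the tree. The coefficients of both seeds lie in one tropical
  semifield and are free of z, so that \<open>\<Phi>\<close> and \<open>\<Psi>\<close> agree on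
  them. The inner coefficients of the exchange polynomials are described through some index
  \<open>r\<close> because mutation reverses the list, which preserves the binomial
  coefficients.\<close>

definition companions ::
  "('n coefvar trop, 'n ratfun, 'n) seed \<Rightarrow> ('n coefvar trop, 'n ratfun, 'n) seed \<Rightarrow> bool" where
  "companions S L \<longleftrightarrow>
     (\<forall>i. cluster S i \<in> A \<and> cluster L i \<in> A' \<and> \<Phi> (cluster S i) = \<Psi> (cluster L i) ^ d i) \<and>
     coeffs_y S = coeffs_y L \<and> (\<forall>i j s. trop_lookup (coeffs_y S i) (Zv j s) = 0) \<and>
     exch L = diag_mat d ** exch S \<and>
     (\<forall>i. length (polys S i) = Suc (d i) \<and> polys S i ! 0 = 1 \<and> polys S i ! d i = 1 \<and>
        (\<forall>s. 0 < s \<and> s < d i \<longrightarrow> (\<exists>r. 0 < r \<and> r < d i \<and>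
           polys S i ! s = trop_gen (Zv i r) \<and> d i choose r = d i choose s))) \<and>
     (\<forall>i. polys L i = [1, 1])"

text \<open>A monomial free of z is a product of integer powers of y-variables, and on these
  \<open>y_eq\<close> holds.\<close>

lemma trop_embed_Y:
  assumes "\<And>j s. trop_lookup m (Zv j s) = 0"
  shows "trop_embed m \<in> A" "trop_embed m \<in> A'" "\<Phi> (trop_embed m) = \<Psi> (trop_embed m)"
proof -
  have *: "\<exists>i. v = Yv i" if "v \<in> Poly_Mapping.keys (expo m)" for v
    using that assms by (cases v) (auto simp: in_keys_iff)
  have in_A: "rvar (Cv v) powi trop_lookup m v \<in> A" if "v \<in> Poly_Mapping.keys (expo m)" for v
    using *[OF that] by (auto intro: sf_closed_powi closed y_in)
  have in_A': "rvar (Cv v) powi trop_lookup m v \<in> A'" if "v \<in> Poly_Mapping.keys (expo m)" for v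
    using *[OF that] by (auto intro: sf_closed_powi closed' y_in')
  show "trop_embed m \<in> A" "trop_embed m \<in> A'"
    unfolding trop_embed_def using in_A in_A'
    by (auto intro: sf_closed_prod closed closed')
  have "\<Phi> (rvar (Cv v) powi trop_lookup m v) = \<Psi> (rvar (Cv v) powi trop_lookup m v)"
    if "v \<in> Poly_Mapping.keys (expo m)" for v
    using *[OF that] by (auto simp: sf_hom_powi[OF hom] sf_hom_powi[OF hom'] y_in y_in' y_eq)
  then show "\<Phi> (trop_embed m) = \<Psi> (trop_embed m)"
    unfolding trop_embed_def
    by (simp add: sf_hom_prod[OF hom] sf_hom_prod[OF hom'] in_A in_A')
qed

lemma pos_part_of_nat_mult: "pos_part (int n * b) = int n * pos_part b"
  by (simp add: pos_part_def max_mult_distrib_left)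

lemma diag_mat_mult: "(diag_mat d ** B) $ i $ j = int (d i) * B $ i $ j"
  by (simp add: matrix_matrix_mult_def diag_mat_def if_distrib[of "\<lambda>a. a * _"] cong: if_cong)

lemma companions_mutate:
  assumes "companions S L"
  shows "companions (mutate trop_embed k S) (mutate trop_embed k L)"
proof -
  note c = assms[unfolded companions_def]
  have clS: "cluster S i \<in> A" and clL: "cluster L i \<in> A'"
    and cl: "\<Phi> (cluster S i) = \<Psi> (cluster L i) ^ d i"
    and y: "coeffs_y L = coeffs_y S" and yZ: "trop_lookup (coeffs_y S i) (Zv j s) = 0"
    and exch: "exch L = diag_mat d ** exch S"
    and len: "length (polys S i) = Suc (d i)" and ends: "polys S i ! 0 = 1" "polys S i ! d i = 1"
    and mid: "0 < s \<Longrightarrow> s < d i \<Longrightarrow> \<exists>r. 0 < r \<and> r < d i \<and>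
           polys S i ! s = trop_gen (Zv i r) \<and> d i choose r = d i choose s"
    and pL: "polys L i = [1, 1]" for i j s
    using c by auto
  have exchL: "exch L $ i $ j = int (d i) * exch S $ i $ j" for i j
    by (simp add: exch diag_mat_mult)
  have degS: "deg S i = d i" and degL: "deg L i = 1" for i
    by (simp_all add: deg_def len pL)

  \<comment> \<open>The exchange polynomials in the tropical semifield\<close>
  define ZS where "ZS = poly_eval_P (polys S k) (coeffs_y S k)"
  define ZL where "ZL = poly_eval_P (polys L k) (coeffs_y S k)"
  have "trop_lookup (polys S k ! s) v \<ge> 0" if "s \<le> d k" for s v
  proof (cases "s = 0 \<or> s = d k")
    case False
    then show ?thesis using mid[of s k] that by auto
  qed (auto simp: ends)
  then have ZS: "trop_lookup ZS v = int (d k) * min 0 (trop_lookup (coeffs_y S k) v)" for v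
    unfolding ZS_def by (rule trop_lookup_poly_eval_P[OF len ends])
  have ZL: "trop_lookup ZL v = min 0 (trop_lookup (coeffs_y S k) v)" for v
    unfolding ZL_def pL
    by (subst trop_lookup_poly_eval_P[where d = 1]) (auto simp: nth_Cons')
  have ZSL: "ZS = ZL ^ d k" by (rule trop_eqI) (simp add: ZS ZL)
  \<comment> \<open>The exponent is \<open>min 0 0\<close>, so \<open>trop_embed_Y\<close> applies
    to \<open>ZL\<close>.\<close>
  have ZL_Y: "trop_lookup ZL (Zv j s) = 0" for j s by (simp add: ZL yZ)
  note embed_y = trop_embed_Y[of "coeffs_y S k", OF yZ] and embed_Z = trop_embed_Y[of ZL, OF ZL_Y]

  \<comment> \<open>Specialization of y-hat and of the exchange polynomials\<close>
  define uS where "uS = y_hat trop_embed S k"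
  define uL where "uL = y_hat trop_embed L k"
  have in_S: "cluster S i powi b \<in> A" and in_L: "cluster L i powi b \<in> A'" for i b
    by (auto intro: sf_closed_powi closed closed' clS clL)
  have prod_S: "(\<Prod>i\<in>UNIV. cluster S i powi b i) \<in> A"
    and prod_L: "(\<Prod>i\<in>UNIV. cluster L i powi b i) \<in> A'" for b
    by (auto intro: sf_closed_prod closed closed' in_S in_L)
  \<comment> \<open>The power \<open>d i\<close> from \<open>cl\<close> moves into the exponent,
    where it turns entries of \<open>B\<close> into entries of \<open>DB\<close>. This serves both
    y-hat and the monomial of the exchange relation.\<close>
  have prod_eq: "\<Phi> (\<Prod>i\<in>UNIV. cluster S i powi b i) =
      \<Psi> (\<Prod>i\<in>UNIV. cluster L i powi (int (d i) * b i))" for b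
  proof -
    have "\<Phi> (cluster S i powi b i) = \<Psi> (cluster L i powi (int (d i) * b i))" for i
      unfolding sf_hom_powi[OF hom clS] sf_hom_powi[OF hom' clL] cl by (simp add: power_int_mult)
    then show ?thesis by (simp add: sf_hom_prod[OF hom] sf_hom_prod[OF hom'] in_S in_L)
  qed
  have uS: "uS \<in> A" and uL: "uL \<in> A'"
    using embed_y prod_S prod_L closed closed'
    by (auto simp: uS_def uL_def y_hat_def y sf_closed_def)
  \<comment> \<open>The two y-hats specialize to the same element, without a power: column
    \<open>k\<close> of \<open>exch L\<close> carries exactly the factors \<open>d i\<close> that
    \<open>prod_eq\<close> produces.\<close>
  have u: "\<Phi> uS = \<Psi> uL"
    using hom hom' embed_y prod_S prod_L prod_eq
    by (simp add: uS_def uL_def y_hat_def y exchL sf_hom_def)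
  \<comment> \<open>At the ends the binomial coefficient is \<open>1\<close>; inside,
    \<open>z_eq\<close> is applied at the index \<open>r\<close> of the invariant, whose binomial
    coefficient equals that of \<open>s\<close>.\<close>
  have coef: "trop_embed (polys S k ! s) \<in> A"
    "\<Phi> (trop_embed (polys S k ! s)) = of_nat (d k choose s)" if "s \<le> d k" for s
  proof -
    have "trop_embed (polys S k ! s) \<in> A \<and>
        \<Phi> (trop_embed (polys S k ! s)) = of_nat (d k choose s)"
    proof (cases "s = 0 \<or> s = d k")
      case True
      then show ?thesis using hom closed by (auto simp: ends sf_hom_def sf_closed_def)
    next
      case False
      then have "0 < s" "s < d k" using that by auto
      then obtain r where "0 < r" "r < d k" "polys S k ! s = trop_gen (Zv k r)"
        "d k choose r = d k choose s"
        using mid by blast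
      then show ?thesis using z_in[of r k] z_eq[of r k] by simp
    qed
    then show "trop_embed (polys S k ! s) \<in> A"
      "\<Phi> (trop_embed (polys S k ! s)) = of_nat (d k choose s)" by auto
  qed
  have term_S: "trop_embed (polys S k ! s) * uS ^ s \<in> A" if "s < Suc (d k)" for s
    using that coef(1)[of s] sf_closed_power[OF closed uS, of s] closed by (auto simp: sf_closed_def)
  have PS: "poly_eval_F trop_embed (polys S k) uS \<in> A"
    unfolding poly_eval_F_def len
    by (rule sf_closed_sum) (auto intro: term_S closed)
  have "\<Phi> (poly_eval_F trop_embed (polys S k) uS) =
      (\<Sum>s<Suc (d k). \<Phi> (trop_embed (polys S k ! s) * uS ^ s))"
    unfolding poly_eval_F_def len
    by (rule sf_hom_sum[OF _ _ hom]) (auto intro: term_S)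
  also have "\<dots> = (\<Sum>s<Suc (d k). of_nat (d k choose s) * \<Phi> uS ^ s)"
  proof (rule sum.cong)
    fix s assume "s \<in> {..<Suc (d k)}"
    then have s: "s \<le> d k" by auto
    show "\<Phi> (trop_embed (polys S k ! s) * uS ^ s) = of_nat (d k choose s) * \<Phi> uS ^ s"
      using hom coef[OF s] sf_closed_power[OF closed uS, of s] sf_hom_power[OF hom uS, of s]
      by (auto simp: sf_hom_def)
  qed simp
  also have "\<dots> = (\<Phi> uS + 1) ^ d k"
    by (simp add: binomial_ring lessThan_Suc_atMost)
  finally have \<Phi>PS: "\<Phi> (poly_eval_F trop_embed (polys S k) uS) = (1 + \<Psi> uL) ^ d k"
    by (simp add: u add.commute)
  have PL_eq: "poly_eval_F trop_embed (polys L k) uL = 1 + uL"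
    by (simp add: poly_eval_F_def pL)
  have PL: "1 + uL \<in> A'" "\<Psi> (1 + uL) = 1 + \<Psi> uL"
    using uL closed' hom' by (auto simp: sf_closed_def sf_hom_def)

  \<comment> \<open>The new cluster variables\<close>
  define xS where "xS = (\<Prod>l\<in>UNIV. cluster S l powi pos_part (- exch S $ l $ k)) ^ d k
      * (poly_eval_F trop_embed (polys S k) uS / trop_embed ZS) / cluster S k"
  \<comment> \<open>In degree \<open>1\<close> the outer power of the monomial is trivial, so
    \<open>xL\<close> has none; \<open>m_eq\<close> compares the monomials before that power is
    taken.\<close>
  define mL where "mL = (\<Prod>l\<in>UNIV. cluster L l powi pos_part (- exch L $ l $ k))"
  define xL where "xL = mL * ((1 + uL) / trop_embed ZL) / cluster L k"
  have mL: "mL \<in> A'" unfolding mL_def by (rule prod_L)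
  have ZS_emb: "trop_embed ZS \<in> A" "\<Phi> (trop_embed ZS) = \<Psi> (trop_embed ZL) ^ d k"
    using sf_closed_power[OF closed embed_Z(1)] sf_hom_power[OF hom embed_Z(1)] embed_Z(3)
    by (auto simp: ZSL trop_embed_power)
  \<comment> \<open>\<open>pos_part\<close> commutes with the nonnegative factor \<open>d l\<close>,
    so the exponents are again those of \<open>prod_eq\<close>.\<close>
  have "pos_part (- exch L $ l $ k) = int (d l) * pos_part (- exch S $ l $ k)" for l
    using pos_part_of_nat_mult[of "d l" "- exch S $ l $ k"] by (simp add: exchL)
  then have m_eq: "\<Phi> (\<Prod>l\<in>UNIV. cluster S l powi pos_part (- exch S $ l $ k)) = \<Psi> mL"
    by (simp add: mL_def prod_eq)
  have mS: "(\<Prod>l\<in>UNIV. cluster S l powi pos_part (- exch S $ l $ k)) ^ d k \<in> A"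
    "\<Phi> ((\<Prod>l\<in>UNIV. cluster S l powi pos_part (- exch S $ l $ k)) ^ d k) = \<Psi> mL ^ d k"
    using sf_hom_power[OF hom prod_S] m_eq by (auto intro: sf_closed_power closed prod_S)
  have quotS: "poly_eval_F trop_embed (polys S k) uS / trop_embed ZS \<in> A"
    and quotL: "(1 + uL) / trop_embed ZL \<in> A'"
    using PS ZS_emb PL embed_Z closed closed' by (auto simp: sf_closed_def)
  have numS: "(\<Prod>l\<in>UNIV. cluster S l powi pos_part (- exch S $ l $ k)) ^ d k
      * (poly_eval_F trop_embed (polys S k) uS / trop_embed ZS) \<in> A"
    and numL: "mL * ((1 + uL) / trop_embed ZL) \<in> A'"
    using mS mL quotS quotL closed closed' unfolding sf_closed_def by blast+
  have xS_in: "xS \<in> A" and xL_in: "xL \<in> A'"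
    using numS numL clS clL closed closed' unfolding xS_def xL_def sf_closed_def by blast+
  have homs: "\<Phi> (a * b) = \<Phi> a * \<Phi> b" "\<Phi> (a / b) = \<Phi> a / \<Phi> b" if "a \<in> A" "b \<in> A" for a b
    using hom that by (auto simp: sf_hom_def)
  have homs': "\<Psi> (a * b) = \<Psi> a * \<Psi> b" "\<Psi> (a / b) = \<Psi> a / \<Psi> b" if "a \<in> A'" "b \<in> A'" for a b
    using hom' that by (auto simp: sf_hom_def)
  \<comment> \<open>Each of the four factors is a \<open>d k\<close>-th power: the monomial by
    definition, the polynomial by the binomial theorem, the tropical value by \<open>ZSL\<close>,
    the old variable by \<open>cl\<close>.\<close>
  have "\<Phi> xS = \<Psi> mL ^ d k * ((1 + \<Psi> uL) ^ d k / \<Psi> (trop_embed ZL) ^ d k) / \<Psi> (cluster L k) ^ d k"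
    by (simp add: xS_def homs mS quotS numS clS PS ZS_emb \<Phi>PS cl
        del: times_divide_eq_left times_divide_eq_right)
  moreover have "\<Psi> xL = \<Psi> mL * ((1 + \<Psi> uL) / \<Psi> (trop_embed ZL)) / \<Psi> (cluster L k)"
    by (simp add: xL_def homs' mL quotL numL clL PL embed_Z
        del: times_divide_eq_left times_divide_eq_right)
  ultimately have x_eq: "\<Phi> xS = \<Psi> xL ^ d k"
    by (simp add: power_divide power_mult_distrib)

  \<comment> \<open>The mutated seeds and the invariant\<close>
  have mutS: "mutate trop_embed k S =
    \<lparr> cluster = (\<lambda>i. if i = k then xS else cluster S i),
      coeffs_y = (\<lambda>j. if j = k then inverse (coeffs_y S k)
        else coeffs_y S j * (coeffs_y S k ^ d k) powi pos_part (exch S $ k $ j) * ZS powi (- exch S $ k $ j)),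
      exch = (\<chi> i j. if i = k \<or> j = k then - exch S $ i $ j
        else exch S $ i $ j + pos_part (exch S $ i $ k) * int (d k) * exch S $ k $ j
          + exch S $ i $ k * int (d k) * pos_part (- exch S $ k $ j)),
      polys = (\<lambda>i. if i = k then rev (polys S k) else polys S i) \<rparr>"
    by (simp add: mutate_def Let_def degS xS_def ZS_def uS_def cong: if_cong)
  have mutL: "mutate trop_embed k L =
    \<lparr> cluster = (\<lambda>i. if i = k then xL else cluster L i),
      coeffs_y = (\<lambda>j. if j = k then inverse (coeffs_y S k)
        else coeffs_y S j * coeffs_y S k powi pos_part (exch L $ k $ j) * ZL powi (- exch L $ k $ j)),
      exch = (\<chi> i j. if i = k \<or> j = k then - exch L $ i $ j
        else exch L $ i $ j + pos_part (exch L $ i $ k) * exch L $ k $ j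
          + exch L $ i $ k * pos_part (- exch L $ k $ j)),
      polys = (\<lambda>i. [1, 1]) \<rparr>"
    using PL_eq
    by (simp add: mutate_def Let_def degL xL_def ZL_def uL_def mL_def y pL cong: if_cong)
  have neg: "pos_part (- (int n * b)) = int n * pos_part (- b)" for n b
    using pos_part_of_nat_mult[of n "- b"] by simp
  \<comment> \<open>Row \<open>k\<close> of \<open>exch L\<close> is \<open>d k\<close> times that
    of \<open>exch S\<close>; this factor accounts for the power \<open>d k\<close> of
    \<open>coeffs_y S k\<close> and for \<open>ZS = ZL ^ d k\<close>.\<close>
  have y': "coeffs_y (mutate trop_embed k S) = coeffs_y (mutate trop_embed k L)"
    unfolding mutS mutL
    by (auto simp: fun_eq_iff ZS ZL exchL pos_part_of_nat_mult intro!: trop_eqI)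
  have yZ': "trop_lookup (coeffs_y (mutate trop_embed k S) i) (Zv j s) = 0" for i j s
    by (simp add: mutS ZS yZ)
  \<comment> \<open>Away from row and column \<open>k\<close>, every term has the factor
    \<open>d i\<close> from row \<open>i\<close>, and the \<open>d k\<close> in the rule for
    \<open>S\<close> is the one contained in \<open>exch L $ k $ j\<close>.\<close>
  have exch': "exch (mutate trop_embed k L) = diag_mat d ** exch (mutate trop_embed k S)"
    by (simp add: mutS mutL vec_eq_iff diag_mat_mult exchL pos_part_of_nat_mult neg algebra_simps)
  have nth_rev: "rev (polys S k) ! s = polys S k ! (d k - s)" if "s \<le> d k" for s
    using that by (simp add: rev_nth len)
  \<comment> \<open>Position \<open>s\<close> of the reversed list holds the old entry at
    \<open>d k - s\<close>, and the binomial coefficients at \<open>s\<close> and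
    \<open>d k - s\<close> coincide.\<close>
  have mid': "\<exists>r. 0 < r \<and> r < d k \<and> rev (polys S k) ! s = trop_gen (Zv k r) \<and>
      d k choose r = d k choose s" if "0 < s" "s < d k" for s
    using mid[of "d k - s" k] that binomial_symmetric[of s "d k"] by (auto simp: nth_rev)
  show ?thesis
    unfolding companions_def
  proof (intro conjI)
    show "\<forall>i. cluster (mutate trop_embed k S) i \<in> A \<and> cluster (mutate trop_embed k L) i \<in> A' \<and>
        \<Phi> (cluster (mutate trop_embed k S) i) = \<Psi> (cluster (mutate trop_embed k L) i) ^ d i"
      by (simp add: mutS mutL xS_in xL_in x_eq clS clL cl)
    show "\<forall>i. length (polys (mutate trop_embed k S) i) = Suc (d i) \<and>
        polys (mutate trop_embed k S) i ! 0 = 1 \<and> polys (mutate trop_embed k S) i ! d i = 1 \<and>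
        (\<forall>s. 0 < s \<and> s < d i \<longrightarrow> (\<exists>r. 0 < r \<and> r < d i \<and>
           polys (mutate trop_embed k S) i ! s = trop_gen (Zv i r) \<and> d i choose r = d i choose s))"
      using mid mid' by (auto simp: mutS len ends nth_rev)
    show "\<forall>i. polys (mutate trop_embed k L) i = [1, 1]" by (simp add: mutL)
  qed (use y' yZ' exch' in auto)
qed

text \<open>The initial cluster of the companion seed consists of the x-variables themselves instead
  of their roots; \<open>x_eq\<close> is the trace of the roots that the induction needs.\<close>

lemma companions_seed_at:
  assumes x_in: "\<And>i. xvar i \<in> A" and x_in': "\<And>i. xvar i \<in> A'"
    and x_eq: "\<And>i. \<Phi> (xvar i) = \<Psi> (xvar i) ^ d i"
  shows "companions (seed_at trop_embed (indet_seed B d) t)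
           (seed_at trop_embed (indet_seed (diag_mat d ** B) (\<lambda>i. 1)) t)"
proof (induction t rule: rev_induct)
  case Nil
  show ?case
    using d_pos assms by (auto simp: companions_def seed_at_def indet_seed_def nth_append)
next
  case (snoc k t)
  then show ?case using companions_mutate by (simp add: seed_at_def)
qed

end

section \<open>Specialized F-polynomials\<close>

lemma sf_hom_x_to_1:
  "sf_hom (Qsf (x_vars \<union> Cv ` W)) (Qsf (Cv ` W)) (rat_subst (case_var (\<lambda>i. 1) (\<lambda>w. rvar (Cv w))))"
  by (rule sf_hom_rat_subst[OF sf_closed_Qsf]) (auto intro: Qsf.one Qsf.var[OF imageI])

text \<open>F-polynomials are X-functions at x = 1, so both sides come from values of the composite
  homomorphisms \<open>?\<Phi>\<close> and \<open>?\<Psi>\<close> at X-functions. The family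
  \<open>Y\<close> is left general to cover y as well as y-hat.\<close>

lemma F_polynomial_binomial:
  fixes d :: "'n::{finite,linorder} \<Rightarrow> nat" and Y :: "'n \<Rightarrow> 'n ratfun"
  assumes d: "\<And>i. d i > 0" and Y: "\<And>i. Y i \<in> Qsf U"
  shows "subst_yz (F_polynomial B d t j) Y (z_bin d) \<in> Qsf U"
    and "subst_y (F_polynomial (diag_mat d ** B) (\<lambda>i. 1) t j) Y ^ d j \<in> Qsf U"
    and "subst_yz (F_polynomial B d t j) Y (z_bin d) =
         subst_y (F_polynomial (diag_mat d ** B) (\<lambda>i. 1) t j) Y ^ d j"
proof -
  define W :: "'n coefvar set" where "W = range Yv \<union> {Zv i s | i s. 0 < s \<and> s < d i}"
  define W' :: "'n coefvar set" where "W' = range Yv"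
  let ?\<sigma> = "case_var (\<lambda>i. 1) (\<lambda>w. rvar (Cv w)) :: 'n var \<Rightarrow> 'n ratfun"
  let ?\<tau> = "case_var (\<lambda>i. xvar i) (case_coefvar Y (z_bin d)) :: 'n var \<Rightarrow> 'n ratfun"
  let ?\<tau>' = "case_var (\<lambda>i. xvar i) (case_coefvar Y (\<lambda>i s. zvar i s)) :: 'n var \<Rightarrow> 'n ratfun"
  let ?A = "Qsf (x_vars \<union> Cv ` W)" and ?A' = "Qsf (x_vars \<union> Cv ` W')"
  let ?\<Phi> = "rat_subst ?\<tau> \<circ> rat_subst ?\<sigma>" and ?\<Psi> = "rat_subst ?\<tau>' \<circ> rat_subst ?\<sigma>"
  have bin: "z_bin d i s \<in> Qsf U" if "s < d i" for i s
    using that by (auto simp: z_bin_def intro!: sf_closed_of_nat sf_closed_Qsf)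
  have "sf_hom (Qsf (Cv ` W)) (Qsf U) (rat_subst ?\<tau>)"
    by (rule sf_hom_rat_subst[OF sf_closed_Qsf]) (auto simp: W_def Y bin)
  then have hom: "sf_hom ?A (Qsf U) ?\<Phi>" using sf_hom_x_to_1 by (rule sf_hom_comp[rotated])
  have "sf_hom (Qsf (Cv ` W')) (Qsf U) (rat_subst ?\<tau>')"
    by (rule sf_hom_rat_subst[OF sf_closed_Qsf]) (auto simp: W'_def Y)
  then have hom': "sf_hom ?A' (Qsf U) ?\<Psi>" using sf_hom_x_to_1 by (rule sf_hom_comp[rotated])
  interpret binomial_specialization d ?A ?A' "Qsf U" ?\<Phi> ?\<Psi>
  proof
    show "?\<Phi> (zvar i s) = of_nat (d i choose s)" for i s
      by (simp add: rat_subst_rvar z_bin_def)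
  qed (use hom hom' d in \<open>auto simp: rat_subst_rvar W_def W'_def intro: Qsf.var\<close>)
  \<comment> \<open>The first substitution sends the x-variables to \<open>1\<close>, so
    \<open>x_eq\<close> reduces to \<open>1 = 1 ^ d i\<close>. With \<open>{}\<close> as the set of
    variables nothing is asked of the substituted values.\<close>
  have one: "rat_subst ?\<tau> 1 = 1" "rat_subst ?\<tau>' 1 = 1"
    using sf_hom_rat_subst[of "Qsf UNIV" "{}", OF sf_closed_Qsf]
    by (auto simp: sf_hom_def)
  have comp: "companions (seed_at trop_embed (indet_seed B d) t)
           (seed_at trop_embed (indet_seed (diag_mat d ** B) (\<lambda>i. 1)) t)"
    by (rule companions_seed_at) (auto simp: rat_subst_rvar one intro: Qsf.var)
  have F: "subst_yz (F_polynomial B d t j) Y (z_bin d) = ?\<Phi> (X_function B d t j)"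
    by (simp add: subst_yz_def F_polynomial_def)
  have L: "subst_y (F_polynomial (diag_mat d ** B) (\<lambda>i. 1) t j) Y =
      ?\<Psi> (X_function (diag_mat d ** B) (\<lambda>i. 1) t j)"
    by (simp add: subst_y_def subst_yz_def F_polynomial_def)
  show eq: "subst_yz (F_polynomial B d t j) Y (z_bin d) =
         subst_y (F_polynomial (diag_mat d ** B) (\<lambda>i. 1) t j) Y ^ d j"
    unfolding F L using comp unfolding companions_def X_function_def by blast
  have "X_function B d t j \<in> ?A"
    using comp unfolding companions_def X_function_def by blast
  then show mem: "subst_yz (F_polynomial B d t j) Y (z_bin d) \<in> Qsf U"
    unfolding F using hom by (auto simp: sf_hom_def)
  show "subst_y (F_polynomial (diag_mat d ** B) (\<lambda>i. 1) t j) Y ^ d j \<in> Qsf U"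
    using mem unfolding eq .
qed

theorem proposition4p3:
  fixes \<iota> :: "'p::semifield \<Rightarrow> 'f::field"
    and S :: "('p, 'f, 'n::{finite,linorder}) seed"
    and t :: "'n list" and j :: 'n
  assumes "gen_seed \<iota> S"
    and "t \<in> reg_tree"
  shows "subst_yz (gen_F S t j) yvar (z_bin (deg S)) \<in> Qsf y_vars
       \<and> subst_y (left_F S t j) yvar ^ deg S j \<in> Qsf y_vars
       \<and> subst_yz (gen_F S t j) yvar (z_bin (deg S)) = subst_y (left_F S t j) yvar ^ deg S j
       \<and> subst_yz (gen_F S t j) (y_hat_var (exch S)) (z_bin (deg S)) \<in> Qsf (x_vars \<union> y_vars)
       \<and> subst_y (left_F S t j) (y_hat_var (exch S)) ^ deg S j \<in> Qsf (x_vars \<union> y_vars)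
       \<and> subst_yz (gen_F S t j) (y_hat_var (exch S)) (z_bin (deg S))
           = subst_y (left_F S t j) (y_hat_var (exch S)) ^ deg S j"
proof -
  have d: "deg S i > 0" for i
    using assms(1) unfolding gen_seed_def by (metis One_nat_def Suc_le_lessD)
  have y: "yvar i \<in> Qsf y_vars" for i by (auto intro: Qsf.var)
  have "(\<Prod>l\<in>UNIV. xvar l powi (exch S $ l $ i)) \<in> Qsf (x_vars \<union> y_vars)" for i
    by (auto intro!: sf_closed_prod sf_closed_powi sf_closed_Qsf Qsf.var)
  then have yhat: "y_hat_var (exch S) i \<in> Qsf (x_vars \<union> y_vars)" for i
    by (auto simp: y_hat_var_def intro!: Qsf.mult Qsf.var)
  show ?thesis
    unfolding gen_F_def left_F_def
    \<comment> \<open>Once with y and \<open>U = y_vars\<close>, once with y-hat and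
      \<open>U = x_vars \<union> y_vars\<close>; each instance gives two memberships and one
      equality.\<close>
    by (intro conjI F_polynomial_binomial[OF d y] F_polynomial_binomial[OF d yhat])
qed

end
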